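(* Let $\mathbf H_{SH}(\lambda)$, $\mathbf H_{R}(\alpha,\lambda)$, $\mathbf H_{GR}(\alpha,\lambda)$, $\mathbf H_{GR}(\alpha,\beta,\lambda)$, $\mathbf H_{T}(\alpha,\lambda)$, $\mathbf H_{SM}(\alpha,\beta,\lambda)$ denote the entropies of the Poisson distribution with parameter $\lambda>0$ (see context). (a) The Shannon, Rényi and both generalized Rényi entropies $\mathbf H_{SH}(\lambda)$, $\mathbf H_{R}(\alpha,\lambda)$, $\mathbf H_{GR}(\alpha,\lambda)$, $\mathbf H_{GR}(\alpha,\beta,\lambda)$, for all admissible values of the parameters, converge to infinity as $\lambda\to\infty$. Moreover, as $\lambda\to\infty$, $$\mathbf H_{SH}(\lambda)\sim \frac{1}{2}\log(2\pi\lambda)+\frac12,$$ $$\mathbf H_R(\alpha,\lambda)\sim \frac{1}{2}\log(2\pi\lambda)+\frac{\log\alpha}{2(\alpha-1)},$$ $$\mathbf H_{GR}(\alpha,\beta,\lambda)\sim \frac{1}{2}\log(2\pi\lambda)+\frac{\log\beta-\log\alpha}{2(\beta-\alpha)}.$$ (b) The Tsallis entropy $\mathbf H_T(\alpha,\lambda)$ converges to infinity as $\lambda\to\infty$ only for $\alpha\in(0,1)$; more precisely, $$\mathbf H_{T}(\alpha,\lambda)\sim \frac{1}{\sqrt{\alpha}\,(1-\alpha)}(2\pi\lambda)^{\frac{1-\alpha}{2}},\qquad \lambda\to\infty,\ \alpha\in(0,1),$$ and $$\lim_{\lambda\to\infty}\mathbf H_{T}(\alpha,\lambda)=\frac{1}{\alpha-1},\qquad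 \alpha>1.$$ (c) The Sharma--Mittal entropy $\mathbf H_{SM}(\alpha,\beta,\lambda)$ converges to infinity as $\lambda\to\infty$ only for $\beta\in(0,1)$; more precisely, $$\mathbf H_{SM}(\alpha,\beta,\lambda)\sim \frac{1}{(1-\beta)\,\alpha^{\frac{1-\beta}{2(1-\alpha)}}}(2\pi\lambda)^{\frac{1-\beta}{2}},\qquad \lambda\to\infty,\ \beta\in(0,1),$$ and $$\lim_{\lambda\to\infty}\mathbf H_{SM}(\alpha,\beta,\lambda)=\frac{1}{\beta-1},\qquad \beta>1.$$
   Context: For $\lambda>0$ let $p_i(\lambda)=e^{-\lambda}\lambda^i/i!$, $i\ge0$ (Poisson distribution). $\log$ is the natural logarithm. The entropies, with their admissible parameters, are: $\mathbf H_{SH}(\lambda)=-\sum_{i\ge0}p_i(\lambda)\log p_i(\lambda)$ (Shannon); $\mathbf H_R(\alpha,\lambda)=\frac1{1-\alpha}\log\sum_{i\ge0}p_i(\lambda)^\alpha$, $\alpha>0$, $\alpha\neq1$ (Rényi); $\mathbf H_{GR}(\alpha,\lambda)=-\frac{\sum_{i\ge0}p_i(\lambda)^\alpha\log p_i(\lambda)}{\sum_{i\ge0}p_i(\lambda)^\alpha}$, $\alpha>0$ (one-parameter generalized Rényi); $\mathbf H_{GR}(\alpha,\beta,\lambda)=\frac1{\beta-\alpha}\log\frac{\sum_{i\ge0}p_i(\lambda)^\alpha}{\sum_{i\ge0}p_i(\lambda)^\beta}$, $\alpha,\beta>0$, $\alpha\ne\beta$ (two-parameter generalized Rényi); $\mathbf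 H_T(\alpha,\lambda)=\frac1{1-\alpha}\bigl(\sum_{i\ge0}p_i(\lambda)^\alpha-1\bigr)$, $\alpha>0$, $\alpha\ne1$ (Tsallis); $\mathbf H_{SM}(\alpha,\beta,\lambda)=\frac1{1-\beta}\Bigl(\bigl(\sum_{i\ge0}p_i(\lambda)^\alpha\bigr)^{\frac{1-\beta}{1-\alpha}}-1\Bigr)$, $\alpha,\beta>0$, $\alpha\neq1$, $\beta\ne1$ (Sharma--Mittal). The notation $f(\lambda)\sim g(\lambda)$ as $\lambda\to\infty$ means $f(\lambda)/g(\lambda)\to1$. *)

theory Defs
  imports "HOL-Probability.Probability"
begin

text \<open>
  Entropies of the Poisson distribution with rate \<open>\<mu>\<close>. All of them are meant for \<open>\<mu> > 0\<close> and for the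
  parameters recorded as admissible below; in that range every series converges absolutely.
\<close>

abbreviation poisson_prob :: "real \<Rightarrow> nat \<Rightarrow> real" where
  "poisson_prob \<mu> i \<equiv> pmf (poisson_pmf \<mu>) i"

lemma poisson_prob_eq:
  "\<mu> > 0 \<Longrightarrow> poisson_prob \<mu> i = exp (-\<mu>) * \<mu> ^ i / fact i"
  by simp

definition shannon_entropy :: "real \<Rightarrow> real" where
  "shannon_entropy \<mu> = - (\<Sum>i. poisson_prob \<mu> i * ln (poisson_prob \<mu> i))"

text \<open>Admissible: \<open>\<alpha> > 0\<close>, \<open>\<alpha> \<noteq> 1\<close>.\<close>

definition renyi_entropy :: "real \<Rightarrow> real \<Rightarrow> real" where
  "renyi_entropy \<alpha> \<mu> = 1 / (1 - \<alpha>) * ln (\<Sum>i. poisson_prob \<mu> i powr \<alpha>)"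

text \<open>One-parameter generalized Renyi entropy. Admissible: \<open>\<alpha> > 0\<close>.\<close>

definition gen_renyi_entropy1 :: "real \<Rightarrow> real \<Rightarrow> real" where
  "gen_renyi_entropy1 \<alpha> \<mu> =
     - ((\<Sum>i. poisson_prob \<mu> i powr \<alpha> * ln (poisson_prob \<mu> i)) /
        (\<Sum>i. poisson_prob \<mu> i powr \<alpha>))"

text \<open>Two-parameter generalized Renyi entropy. Admissible: \<open>\<alpha>, \<beta> > 0\<close>, \<open>\<alpha> \<noteq> \<beta>\<close>.\<close>

definition gen_renyi_entropy2 :: "real \<Rightarrow> real \<Rightarrow> real \<Rightarrow> real" where
  "gen_renyi_entropy2 \<alpha> \<beta> \<mu> =
     1 / (\<beta> - \<alpha>) *
       ln ((\<Sum>i. poisson_prob \<mu> i powr \<alpha>) / (\<Sum>i. poisson_prob \<mu> i powr \<beta>))"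

text \<open>Admissible: \<open>\<alpha> > 0\<close>, \<open>\<alpha> \<noteq> 1\<close>.\<close>

definition tsallis_entropy :: "real \<Rightarrow> real \<Rightarrow> real" where
  "tsallis_entropy \<alpha> \<mu> = 1 / (1 - \<alpha>) * ((\<Sum>i. poisson_prob \<mu> i powr \<alpha>) - 1)"

text \<open>Admissible: \<open>\<alpha>, \<beta> > 0\<close>, \<open>\<alpha> \<noteq> 1\<close>, \<open>\<beta> \<noteq> 1\<close>.\<close>

definition sharma_mittal_entropy :: "real \<Rightarrow> real \<Rightarrow> real \<Rightarrow> real" where
  "sharma_mittal_entropy \<alpha> \<beta> \<mu> =
     1 / (1 - \<beta>) *
       ((\<Sum>i. poisson_prob \<mu> i powr \<alpha>) powr ((1 - \<beta>) / (1 - \<alpha>)) - 1)"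

end

theory Submission
  imports Defs "HOL-Real_Asymp.Real_Asymp"
begin

text \<open>
  Everything rests on \<open>S \<alpha> \<mu> = \<Sum>i. p\<^sub>i powr \<alpha> \<sim> (2 * pi * \<mu>) powr ((1 - \<alpha>) / 2) / sqrt \<alpha>\<close>. Write the sum as
  the integral of a step function and rescale to \<open>i = \<lfloor>\<mu> + sqrt \<mu> * x\<rfloor>\<close>. Divided by the probability of
  the mode, \<open>p\<^sub>i\<close> converges to \<open>exp (- x\<^sup>2 / 2)\<close> and is dominated by a multiple of \<open>exp (- \<bar>x\<bar>)\<close>, so dominated
  convergence gives \<open>S \<alpha> \<mu>\<close> in terms of the probability of the mode. The case \<open>\<alpha> = 1\<close>, where the sum is \<open>1\<close>,
  then determines that probability, which makes Stirling's formula unnecessary.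

  Since \<open>ln (S \<alpha> \<mu>)\<close> is convex in \<open>\<alpha>\<close> with derivative minus the one-parameter generalized Renyi
  entropy, that entropy (the Shannon entropy for \<open>\<alpha> = 1\<close>) lies between two difference quotients, which are
  two-parameter entropies. The Tsallis entropy is the Sharma-Mittal entropy with \<open>\<beta> = \<alpha>\<close>.
\<close>

section \<open>Integrals\<close>

text \<open>The half-line splits into the unit intervals \<open>[k, k + 1)\<close>, on each of which
  the step function is constant, and nonnegative integrals commute with the series. Summability of
  \<open>f\<close> is part of the conclusion: it comes from the finiteness of the integral.\<close>

lemma floor_step_integral:
  fixes f :: "nat \<Rightarrow> real"
  assumes nonneg: "\<And>k. 0 \<le> f k"
    and int: "integrable lborel (\<lambda>t::real. if 0 \<le> t then f (nat \<lfloor>t\<rfloor>) else 0)"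
  shows "f sums (LINT t|lborel. (if 0 \<le> (t::real) then f (nat \<lfloor>t\<rfloor>) else 0))"
proof -
  let ?h = "\<lambda>t::real. if 0 \<le> t then f (nat \<lfloor>t\<rfloor>) else 0"
  have eq: "ennreal (?h t) = (\<Sum>k. ennreal (f k) * indicator {real k..<real (Suc k)} t)" for t :: real
  proof (cases "0 \<le> t")
    case True
    have iff: "t \<in> {real k..<real (Suc k)} \<longleftrightarrow> k = nat \<lfloor>t\<rfloor>" for k
      using True by (auto simp: le_nat_iff floor_eq_iff nat_eq_iff) linarith+
    have "(\<Sum>k. ennreal (f k) * indicator {real k..<real (Suc k)} t)
        = (\<Sum>k\<in>{nat \<lfloor>t\<rfloor>}. ennreal (f k) * indicator {real k..<real (Suc k)} t)"
      using iff by (intro suminf_finite) (auto simp: indicator_def simp del: of_nat_Suc)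
    also have "\<dots> = ennreal (?h t)"
      using True iff[of "nat \<lfloor>t\<rfloor>"] by (simp add: indicator_def del: of_nat_Suc)
    finally show ?thesis ..
  qed (auto simp: indicator_def)
  have "ennreal (LINT t|lborel. ?h t) = (\<integral>\<^sup>+t. ennreal (?h t) \<partial>lborel)"
    using int nonneg by (intro nn_integral_eq_integral[symmetric]) auto
  also have "\<dots> = (\<integral>\<^sup>+t. (\<Sum>k. ennreal (f k) * indicator {real k..<real (Suc k)} t) \<partial>lborel)"
    by (simp only: eq)
  also have "\<dots> = (\<Sum>k. \<integral>\<^sup>+t. ennreal (f k) * indicator {real k..<real (Suc k)} t \<partial>lborel)"
    by (rule nn_integral_suminf) measurable
  also have "\<dots> = (\<Sum>k. ennreal (f k))"
    by (simp add: nn_integral_cmult_indicator)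
  finally have suminf: "(\<Sum>k. ennreal (f k)) = ennreal (LINT t|lborel. ?h t)" ..
  then have "summable f"
    using nonneg by (intro summable_suminf_not_top) auto
  moreover from this have "ennreal (\<Sum>k. f k) = ennreal (LINT t|lborel. ?h t)"
    using suminf nonneg by (simp add: suminf_ennreal2)
  then have "(\<Sum>k. f k) = (LINT t|lborel. ?h t)"
    by (subst (asm) ennreal_inj) (auto intro!: suminf_nonneg Bochner_Integration.integral_nonneg simp: nonneg \<open>summable f\<close>)
  ultimately show ?thesis
    by (simp add: sums_iff)
qed

text \<open>Substitution \<open>t = a + s * x\<close> in the unscaled version; the factor
  \<open>s\<close> is the Jacobian.\<close>

lemma rescaled_floor_step_integral:
  fixes f :: "nat \<Rightarrow> real"
  assumes nonneg: "\<And>k. 0 \<le> f k" and s: "0 < s"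
    and int: "integrable lborel (\<lambda>x. if 0 \<le> a + s * x then f (nat \<lfloor>a + s * x\<rfloor>) else 0)"
  shows "f sums (s * (LINT x|lborel. (if 0 \<le> a + s * x then f (nat \<lfloor>a + s * x\<rfloor>) else 0)))"
proof -
  let ?h = "\<lambda>t::real. if 0 \<le> t then f (nat \<lfloor>t\<rfloor>) else 0"
  have "integrable lborel ?h"
    using lborel_integrable_real_affine_iff[of s ?h a] int s by simp
  from floor_step_integral[OF nonneg this] show ?thesis
    using lborel_integral_real_affine[of s ?h a] s by simp
qed

text \<open>The exponential density plus its reflection, divided by \<open>a\<close>, is an
  integrable majorant.\<close>

lemma integrable_exp_neg_abs:
  fixes a :: real
  assumes "0 < a"
  shows "integrable lborel (\<lambda>x. exp (- a * \<bar>x\<bar>))"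
proof -
  have "integrable lborel (exponential_density a)"
  proof -
    interpret prob_space "density lborel (exponential_density a)"
      using assms by (rule prob_space_exponential_density)
    show ?thesis
      using emeasure_space_1 assms
      by (intro integrableI_nonneg) (auto simp: emeasure_density exponential_density_nonneg)
  qed
  then have "integrable lborel (\<lambda>x. exponential_density a x + exponential_density a (0 + (-1) * x))"
    by (intro Bochner_Integration.integrable_add lborel_integrable_real_affine) auto
  then have "integrable lborel (\<lambda>x. (exponential_density a x + exponential_density a (0 + (-1) * x)) / a)"
    by simp
  \<comment> \<open>Domination rather than equality, because at \<open>x = 0\<close> both densities
    contribute and the majorant has the value 2.\<close>
  then show ?thesis
    by (rule Bochner_Integration.integrable_bound)
       (use assms in \<open>auto simp: erlang_density_def field_simps abs_if\<close>)
qed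

text \<open>The integrand is a multiple of the normal density with variance \<open>1 / a\<close>,
  whose total mass is 1.\<close>

lemma gaussian_integral:
  fixes a :: real
  assumes "0 < a"
  shows "(LINT x|lborel. exp (- (a * x\<^sup>2 / 2))) = sqrt (2 * pi / a)"
proof -
  have "exp (- (a * x\<^sup>2 / 2)) = sqrt (2 * pi / a) * normal_density 0 (1 / sqrt a) x" for x
    using assms by (simp add: normal_density_def power_divide real_sqrt_mult real_sqrt_divide)
  then show ?thesis
    using assms by simp
qed

section \<open>Decay and local limit of Poisson probabilities\<close>

declare pmf_poisson [simp del]

lemma poisson_prob_pos [simp]: "0 < \<mu> \<Longrightarrow> 0 < poisson_prob \<mu> k"
  by (simp add: pmf_poisson)

lemma poisson_prob_neq_0 [simp]: "0 < \<mu> \<Longrightarrow> poisson_prob \<mu> k \<noteq> 0"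
  by (simp add: pmf_poisson)

text \<open>The decay and local limit estimates see the distribution only through positivity and
  this ratio of neighbours.\<close>

lemma poisson_prob_Suc: "0 < \<mu> \<Longrightarrow> poisson_prob \<mu> (Suc k) = poisson_prob \<mu> k * (\<mu> / real (Suc k))"
  by (simp add: pmf_poisson field_simps)

section \<open>Exponential decay of the probabilities away from the mode, on the scale
  \<open>sqrt \<mu>\<close>\<close>

text \<open>Up to index \<open>3 * s\<close> the exponent on the right is nonnegative, so
  monotonicity suffices; beyond it every step gains the factor \<open>exp (- 1 / s)\<close>.\<close>

lemma eventual_geometric_decay:
  fixes q :: "nat \<Rightarrow> real"
  assumes s: "1 \<le> s" and nonneg: "0 \<le> q 0"
    and antimono: "\<And>n. q (Suc n) \<le> q n"
    and decay: "\<And>n. 2 * s \<le> real n \<Longrightarrow> q (Suc n) \<le> q n * exp (- 1 / s)"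
  shows "q n \<le> q 0 * exp (3 - real n / s)"
proof (induction n)
  case 0
  show ?case
    using nonneg by (simp add: mult_left_le_one_le mult_le_cancel_left1)
next
  case (Suc n)
  show ?case
  proof (cases "real (Suc n) \<le> 3 * s")
    case True
    have "q (Suc n) \<le> q 0 * 1"
      using lift_Suc_antimono_le[of q 0 "Suc n"] antimono by simp
    also have "\<dots> \<le> q 0 * exp (3 - real (Suc n) / s)"
      using True s nonneg by (intro mult_left_mono) (simp_all add: field_simps)
    finally show ?thesis .
  next
    case False
    \<comment> \<open>From \<open>Suc n > 3 * s\<close> and \<open>s \<ge> 1\<close> follows
      \<open>n \<ge> 2 * s\<close>; the constant 3 leaves room for this shift by one.\<close>
    then have "q (Suc n) \<le> q n * exp (- 1 / s)"
      using s by (intro decay) simp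
    also have "\<dots> \<le> q 0 * exp (3 - real n / s) * exp (- 1 / s)"
      using Suc by (intro mult_right_mono) simp_all
    also have "\<dots> = q 0 * exp (3 - real (Suc n) / s)"
      by (simp add: mult.assoc exp_add[symmetric] add_divide_distrib algebra_simps)
    finally show ?thesis .
  qed
qed

text \<open>To the right of the mode the ratio of neighbours is at most 1, and once the distance
  reaches \<open>2 * sqrt \<mu>\<close> it is at most \<open>1 - 1 / sqrt \<mu>\<close>.\<close>

lemma poisson_prob_right_decay:
  assumes \<mu>: "4 \<le> \<mu>"
  shows "poisson_prob \<mu> (nat \<lfloor>\<mu>\<rfloor> + n) \<le> poisson_prob \<mu> (nat \<lfloor>\<mu>\<rfloor>) * exp (3 - real n / sqrt \<mu>)"
proof -
  define m where "m = nat \<lfloor>\<mu>\<rfloor>"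
  define s where "s = sqrt \<mu>"
  have s: "2 \<le> s" "\<mu> = s * s"
    using real_le_rsqrt[of 2 \<mu>] \<mu> by (auto simp: s_def)
  have m: "\<mu> \<le> real (Suc m)"
    using \<mu> by (simp add: m_def) linarith
  have step: "poisson_prob \<mu> (m + Suc n) = poisson_prob \<mu> (m + n) * (\<mu> / real (Suc (m + n)))" for n
    using \<mu> by (simp add: poisson_prob_Suc)
  have "poisson_prob \<mu> (m + n) \<le> poisson_prob \<mu> (m + 0) * exp (3 - real n / s)"
  proof (rule eventual_geometric_decay)
    fix n
    have "\<mu> / real (Suc (m + n)) \<le> 1"
      using m \<mu> by simp
    then show "poisson_prob \<mu> (m + Suc n) \<le> poisson_prob \<mu> (m + n)"
      unfolding step by (intro mult_left_le) simp_all
    assume n: "2 * s \<le> real n"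
    have "\<mu> / real (Suc (m + n)) \<le> \<mu> / (\<mu> + 2 * s)"
      using m n \<mu> s by (intro divide_left_mono) (auto intro!: mult_pos_pos)
    also have "\<dots> = (s * s) / (s * (s + 2))"
      by (simp add: s(2) algebra_simps)
    also have "\<dots> = s / (s + 2)"
      using s(1) by simp
    \<comment> \<open>Equivalent to \<open>2 \<le> s\<close>, that is, to
      \<open>4 \<le> \<mu>\<close>.\<close>
    also have "\<dots> \<le> 1 - 1 / s"
      using s(1) by (simp add: field_simps)
    also have "\<dots> \<le> exp (- 1 / s)"
      using exp_ge_add_one_self[of "- 1 / s"] by simp
    finally show "poisson_prob \<mu> (m + Suc n) \<le> poisson_prob \<mu> (m + n) * exp (- 1 / s)"
      unfolding step by (intro mult_left_mono) simp_all
  qed (use s in simp_all)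
  then show ?thesis
    by (simp add: m_def s_def)
qed

text \<open>Walking down from the mode, the ratio of neighbours is \<open>(m - n) / \<mu>\<close>,
  which has the same kind of bound.\<close>

lemma poisson_prob_left_decay:
  assumes \<mu>: "4 \<le> \<mu>" and n: "n \<le> nat \<lfloor>\<mu>\<rfloor>"
  shows "poisson_prob \<mu> (nat \<lfloor>\<mu>\<rfloor> - n) \<le> poisson_prob \<mu> (nat \<lfloor>\<mu>\<rfloor>) * exp (3 - real n / sqrt \<mu>)"
proof -
  define m where "m = nat \<lfloor>\<mu>\<rfloor>"
  define s where "s = sqrt \<mu>"
  \<comment> \<open>The walk ends after \<open>m\<close> steps. Continuing it by 0 gives a sequence
    on all naturals, and the truncated difference \<open>m - n\<close> keeps the recurrence valid
    past the end.\<close>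
  define q where "q n = (if n \<le> m then poisson_prob \<mu> (m - n) else 0)" for n
  have s: "2 \<le> s" "\<mu> = s * s"
    using real_le_rsqrt[of 2 \<mu>] \<mu> by (auto simp: s_def)
  have m: "real m \<le> \<mu>"
    using \<mu> by (simp add: m_def)
  have q_nonneg: "0 \<le> q n" for n
    by (simp add: q_def)
  have step: "q (Suc n) = q n * (real (m - n) / \<mu>)" for n
  proof (cases "Suc n \<le> m")
    case True
    then have "m - n = Suc (m - Suc n)" by simp
    then show ?thesis
      using \<mu> True poisson_prob_Suc[of \<mu> "m - Suc n"] by (simp add: q_def)
  qed (simp add: q_def)
  have "q n \<le> q 0 * exp (3 - real n / s)"
  proof (rule eventual_geometric_decay)
    fix n
    have "real (m - n) / \<mu> \<le> 1"
      using m \<mu> by simp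
    then show "q (Suc n) \<le> q n"
      unfolding step by (intro mult_left_le q_nonneg)
    assume n: "2 * s \<le> real n"
    show "q (Suc n) \<le> q n * exp (- 1 / s)"
    proof (cases "n \<le> m")
      case True
      then have "real (m - n) / \<mu> \<le> (\<mu> - s) / \<mu>"
        using m n \<mu> s(1) by (intro divide_right_mono) simp_all
      also have "\<dots> = 1 - 1 / s"
        using s by (simp add: s(2) field_simps)
      also have "\<dots> \<le> exp (- 1 / s)"
        using exp_ge_add_one_self[of "- 1 / s"] by simp
      finally show ?thesis
        unfolding step by (intro mult_left_mono q_nonneg)
    qed (simp add: q_def)
  qed (use s q_nonneg in simp_all)
  then show ?thesis
    using n by (simp add: q_def m_def s_def)
qed

text \<open>Both sides together. Measuring distance from \<open>\<mu>\<close> instead of its floor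
  changes it by at most \<open>1 \<le> sqrt \<mu>\<close>, which turns the constant 3 into
  4.\<close>

lemma poisson_prob_decay:
  assumes \<mu>: "4 \<le> \<mu>"
  shows "poisson_prob \<mu> k \<le> poisson_prob \<mu> (nat \<lfloor>\<mu>\<rfloor>) * exp (4 - \<bar>real k - \<mu>\<bar> / sqrt \<mu>)"
proof -
  define m where "m = nat \<lfloor>\<mu>\<rfloor>"
  have "poisson_prob \<mu> k \<le> poisson_prob \<mu> m * exp (3 - \<bar>real k - real m\<bar> / sqrt \<mu>)"
  proof (cases "k \<le> m")
    case True
    then show ?thesis
      using poisson_prob_left_decay[OF \<mu>, of "m - k"] by (simp add: m_def of_nat_diff)
  next
    case False
    then show ?thesis
      using poisson_prob_right_decay[OF \<mu>, of "k - m"] by (simp add: m_def of_nat_diff)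
  qed
  also have "\<dots> \<le> poisson_prob \<mu> m * exp (4 - \<bar>real k - \<mu>\<bar> / sqrt \<mu>)"
  proof -
    have "\<bar>real k - \<mu>\<bar> \<le> \<bar>real k - real m\<bar> + 1"
      using \<mu> by (simp add: m_def) linarith
    moreover have "1 \<le> sqrt \<mu>"
      using \<mu> by simp
    ultimately have "\<bar>real k - \<mu>\<bar> / sqrt \<mu> \<le> (\<bar>real k - real m\<bar> + 1 * sqrt \<mu>) / sqrt \<mu>"
      by (intro divide_right_mono) linarith+
    also have "\<dots> = \<bar>real k - real m\<bar> / sqrt \<mu> + 1"
      using \<mu> by (simp add: add_divide_distrib)
    finally show ?thesis
      by (intro mult_left_mono) simp_all
  qed
  finally show ?thesis
    by (simp add: m_def)
qed

section \<open>Gaussian local limit relative to the mode\<close>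

text \<open>\<open>\<phi>\<close> is the log-probability with the expected Gaussian exponent
  removed, so it should be almost constant near \<open>\<mu>\<close>. In its increment the linear
  term \<open>u\<close> of the quadratic cancels that of \<open>ln (1 + u)\<close>, which leaves an
  error of order \<open>1 / \<mu>\<close>. The hypothesis on \<open>A * sqrt \<mu>\<close> yields
  \<open>\<bar>u\<bar> \<le> 1 / 2\<close>, as the logarithm estimate requires.\<close>

lemma poisson_log_ratio_step:
  fixes \<mu> A :: real and k :: nat
  defines "\<phi> \<equiv> \<lambda>k. ln (poisson_prob \<mu> k) + (real k - \<mu>)\<^sup>2 / (2 * \<mu>)"
  assumes \<mu>: "0 < \<mu>" and A: "A * sqrt \<mu> \<le> \<mu> / 2" and k: "\<bar>real (Suc k) - \<mu>\<bar> \<le> A * sqrt \<mu>"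
  shows "\<bar>\<phi> (Suc k) - \<phi> k\<bar> \<le> (2 * A\<^sup>2 + 1) / \<mu>"
proof -
  define u where "u = (real (Suc k) - \<mu>) / \<mu>"
  have u: "\<bar>u\<bar> \<le> 1 / 2"
    using order_trans[OF k A] \<mu> by (simp add: u_def field_simps)
  have "\<bar>u\<bar> \<le> A * sqrt \<mu> / \<mu>"
    using k \<mu> by (simp add: u_def divide_right_mono del: of_nat_Suc)
  then have "u\<^sup>2 \<le> (A * sqrt \<mu> / \<mu>)\<^sup>2"
    using power_mono[of "\<bar>u\<bar>" "A * sqrt \<mu> / \<mu>" 2] by simp
  also have "\<dots> = A\<^sup>2 / \<mu>"
    using \<mu> unfolding power_divide power_mult_distrib by (simp add: power2_eq_square[of \<mu>])
  finally have u2: "u\<^sup>2 \<le> A\<^sup>2 / \<mu>" .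
  have "ln (poisson_prob \<mu> (Suc k)) = ln (poisson_prob \<mu> k) - ln (1 + u)"
  proof -
    have "\<mu> / real (Suc k) = 1 / (1 + u)"
      using \<mu> by (simp add: u_def field_simps)
    moreover have "1 + u > 0"
      using u by linarith
    ultimately show ?thesis
      using \<mu> by (simp add: poisson_prob_Suc ln_mult ln_div)
  qed
  moreover have "(real (Suc k) - \<mu>)\<^sup>2 / (2 * \<mu>) - (real k - \<mu>)\<^sup>2 / (2 * \<mu>) = u - 1 / (2 * \<mu>)"
    using \<mu> by (simp add: u_def power2_eq_square field_simps)
  ultimately have "\<phi> (Suc k) - \<phi> k = u - ln (1 + u) - 1 / (2 * \<mu>)"
    unfolding \<phi>_def by linarith
  moreover have "\<bar>ln (1 + u) - u\<bar> \<le> 2 * u\<^sup>2"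
    by (rule abs_ln_one_plus_x_minus_x_bound[OF u])
  moreover have "(2 * A\<^sup>2 + 1) / \<mu> = 2 * (A\<^sup>2 / \<mu>) + 1 / \<mu>"
    by (simp add: add_divide_distrib)
  moreover have "0 \<le> 1 / (2 * \<mu>)" "1 / (2 * \<mu>) \<le> 1 / \<mu>"
    using \<mu> by (simp_all add: field_simps)
  ultimately show ?thesis
    using u2 by linarith
qed

text \<open>Telescoping: at most \<open>2 * A * sqrt \<mu>\<close> steps, each costing at most
  \<open>(2 * A\<^sup>2 + 1) / \<mu>\<close>.\<close>

lemma poisson_log_ratio_bound:
  fixes \<mu> A :: real and k l :: nat
  defines "\<phi> \<equiv> \<lambda>k. ln (poisson_prob \<mu> k) + (real k - \<mu>)\<^sup>2 / (2 * \<mu>)"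
  assumes \<mu>: "0 < \<mu>" and A: "A * sqrt \<mu> \<le> \<mu> / 2"
    and k: "\<bar>real k - \<mu>\<bar> \<le> A * sqrt \<mu>" and l: "\<bar>real l - \<mu>\<bar> \<le> A * sqrt \<mu>"
  shows "\<bar>\<phi> k - \<phi> l\<bar> \<le> 2 * A * (2 * A\<^sup>2 + 1) / sqrt \<mu>"
proof -
  have less: "\<bar>\<phi> l - \<phi> k\<bar> \<le> real (l - k) * ((2 * A\<^sup>2 + 1) / \<mu>)"
    if "k \<le> l" and k: "\<bar>real k - \<mu>\<bar> \<le> A * sqrt \<mu>" and l: "\<bar>real l - \<mu>\<bar> \<le> A * sqrt \<mu>" for k l
    using that(1) l
  proof (induction l rule: dec_induct)
    case base
    show ?case by simp
  next
    case (step l)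
    \<comment> \<open>The window is an interval containing \<open>k\<close> and
      \<open>Suc l\<close>, hence also \<open>l\<close>, which lies between them.\<close>
    have "\<bar>real l - \<mu>\<bar> \<le> A * sqrt \<mu>"
      using step k by (auto simp: abs_le_iff)
    then have "\<bar>\<phi> l - \<phi> k\<bar> \<le> real (l - k) * ((2 * A\<^sup>2 + 1) / \<mu>)"
      by (rule step.IH)
    moreover have "\<bar>\<phi> (Suc l) - \<phi> l\<bar> \<le> (2 * A\<^sup>2 + 1) / \<mu>"
      unfolding \<phi>_def using \<mu> A step.prems by (rule poisson_log_ratio_step)
    moreover have "real (Suc l - k) = real (l - k) + 1"
      using step by (simp add: of_nat_diff)
    ultimately show ?case
      by (simp only: distrib_right)
  qed
  have "\<bar>\<phi> k - \<phi> l\<bar> \<le> \<bar>real k - real l\<bar> * ((2 * A\<^sup>2 + 1) / \<mu>)"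
  proof (cases "k \<le> l")
    case True
    then show ?thesis
      using less[OF True k l] by (simp add: of_nat_diff abs_minus_commute)
  next
    case False
    then show ?thesis
      using less[of l k] k l by (simp add: of_nat_diff)
  qed
  also have "\<dots> \<le> (2 * A * sqrt \<mu>) * ((2 * A\<^sup>2 + 1) / \<mu>)"
    using k l \<mu> by (intro mult_right_mono) auto
  also have "\<dots> = 2 * A * (2 * A\<^sup>2 + 1) * (sqrt \<mu> / \<mu>)"
    by simp
  also have "sqrt \<mu> / \<mu> = 1 / sqrt \<mu>"
    using \<mu> by (simp add: sqrt_divide_self_eq inverse_eq_divide)
  finally show ?thesis by simp
qed

text \<open>The difference of the two \<open>\<phi>\<close> values vanishes in the limit, so the
  log-ratio is governed by the quadratic terms, which tend to \<open>x\<^sup>2 / 2\<close> at the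
  rescaled index and to 0 at the mode.\<close>

lemma poisson_prob_local_limit:
  fixes x :: real
  shows "((\<lambda>\<mu>. poisson_prob \<mu> (nat \<lfloor>\<mu> + sqrt \<mu> * x\<rfloor>) / poisson_prob \<mu> (nat \<lfloor>\<mu>\<rfloor>))
           \<longlongrightarrow> exp (- (x\<^sup>2 / 2))) at_top"
proof -
  \<comment> \<open>The extra 1 provides a margin \<open>sqrt \<mu> \<ge> 1\<close> that absorbs the
    rounding by the floor, so both indices stay in the window.\<close>
  define A where "A = \<bar>x\<bar> + 1"
  define k where "k \<mu> = nat \<lfloor>\<mu> + sqrt \<mu> * x\<rfloor>" for \<mu>
  define m where "m \<mu> = nat \<lfloor>\<mu>\<rfloor>" for \<mu> :: real
  define \<phi> where "\<phi> \<mu> k = ln (poisson_prob \<mu> k) + (real k - \<mu>)\<^sup>2 / (2 * \<mu>)" for \<mu> k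
  have A: "0 < A" "\<bar>x\<bar> \<le> A" "1 \<le> A" by (auto simp: A_def)
  \<comment> \<open>\<open>(2 * A)\<^sup>2 \<le> \<mu>\<close> is
    \<open>A * sqrt \<mu> \<le> \<mu> / 2\<close> in another form.\<close>
  have ev: "\<forall>\<^sub>F \<mu> in at_top. 1 \<le> \<mu> \<and> (2 * A)\<^sup>2 \<le> \<mu>"
    by (intro eventually_conj eventually_ge_at_top)
  have bounds: "A * sqrt \<mu> \<le> \<mu> / 2" "\<bar>real (k \<mu>) - \<mu> - sqrt \<mu> * x\<bar> \<le> 1" "\<bar>real (m \<mu>) - \<mu>\<bar> \<le> 1"
      "\<bar>real (k \<mu>) - \<mu>\<bar> \<le> A * sqrt \<mu>" "\<bar>real (m \<mu>) - \<mu>\<bar> \<le> A * sqrt \<mu>" "1 \<le> sqrt \<mu>"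
    if "1 \<le> \<mu> \<and> (2 * A)\<^sup>2 \<le> \<mu>" for \<mu>
  proof -
    have s: "1 \<le> sqrt \<mu>" "2 * A \<le> sqrt \<mu>"
      using that real_le_rsqrt[of "2 * A" \<mu>] by auto
    then show "1 \<le> sqrt \<mu>" by simp
    have "2 * A * sqrt \<mu> \<le> sqrt \<mu> * sqrt \<mu>"
      using s by (intro mult_right_mono) auto
    then show 1: "A * sqrt \<mu> \<le> \<mu> / 2"
      using that by simp
    have x: "\<bar>sqrt \<mu> * x\<bar> \<le> sqrt \<mu> * \<bar>x\<bar>"
      using that by (simp add: abs_mult)
    have As: "A * sqrt \<mu> = sqrt \<mu> * \<bar>x\<bar> + sqrt \<mu>"
      by (simp add: A_def algebra_simps)
    \<comment> \<open>Ensures that \<open>nat\<close> does not truncate the floor.\<close>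
    have "0 \<le> \<mu> + sqrt \<mu> * x"
      using 1 x As s that by linarith
    then show 2: "\<bar>real (k \<mu>) - \<mu> - sqrt \<mu> * x\<bar> \<le> 1"
      unfolding k_def by linarith
    show 3: "\<bar>real (m \<mu>) - \<mu>\<bar> \<le> 1"
      using that unfolding m_def by linarith
    show "\<bar>real (k \<mu>) - \<mu>\<bar> \<le> A * sqrt \<mu>"
      using 2 x s As by linarith
    show "\<bar>real (m \<mu>) - \<mu>\<bar> \<le> A * sqrt \<mu>"
      using 3 A s mult_mono[of 1 A 1 "sqrt \<mu>"] by linarith
  qed
  have lim\<phi>: "((\<lambda>\<mu>. \<phi> \<mu> (k \<mu>) - \<phi> \<mu> (m \<mu>)) \<longlongrightarrow> 0) at_top"
  proof (rule Lim_null_comparison)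
    show "\<forall>\<^sub>F \<mu> in at_top. norm (\<phi> \<mu> (k \<mu>) - \<phi> \<mu> (m \<mu>)) \<le> 2 * A * (2 * A\<^sup>2 + 1) / sqrt \<mu>"
      using ev
    proof eventually_elim
      case (elim \<mu>)
      show ?case
        unfolding \<phi>_def real_norm_def using elim bounds[OF elim]
        by (intro poisson_log_ratio_bound) auto
    qed
    show "((\<lambda>\<mu>. 2 * A * (2 * A\<^sup>2 + 1) / sqrt \<mu>) \<longlongrightarrow> 0) at_top"
      by real_asymp
  qed
  \<comment> \<open>Used with \<open>j = k\<close>, \<open>y = x\<close> and with
    \<open>j = m\<close>, \<open>y = 0\<close>.\<close>
  have close: "((\<lambda>\<mu>. (real (j \<mu>) - \<mu>)\<^sup>2 / (2 * \<mu>)) \<longlongrightarrow> y\<^sup>2 / 2) at_top"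
    if "\<And>\<mu>. 1 \<le> \<mu> \<and> (2 * A)\<^sup>2 \<le> \<mu> \<Longrightarrow> \<bar>real (j \<mu>) - \<mu> - sqrt \<mu> * y\<bar> \<le> 1" for j y
  proof -
    have "((\<lambda>\<mu>. (real (j \<mu>) - \<mu>) / sqrt \<mu> - y) \<longlongrightarrow> 0) at_top"
    proof (rule Lim_null_comparison)
      show "\<forall>\<^sub>F \<mu> in at_top. norm ((real (j \<mu>) - \<mu>) / sqrt \<mu> - y) \<le> 1 / sqrt \<mu>"
        using ev
      proof eventually_elim
        case (elim \<mu>)
        then have "(real (j \<mu>) - \<mu>) / sqrt \<mu> - y = (real (j \<mu>) - \<mu> - sqrt \<mu> * y) / sqrt \<mu>"
          by (simp add: field_simps)
        then show ?case
          using that[OF elim] elim by (simp add: divide_right_mono)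
      qed
      show "((\<lambda>\<mu>. 1 / sqrt \<mu>) \<longlongrightarrow> 0) at_top"
        by real_asymp
    qed
    then have "((\<lambda>\<mu>. (real (j \<mu>) - \<mu>) / sqrt \<mu>) \<longlongrightarrow> y) at_top"
      by (simp add: LIM_zero_iff)
    then have "((\<lambda>\<mu>. ((real (j \<mu>) - \<mu>) / sqrt \<mu>)\<^sup>2 / 2) \<longlongrightarrow> y\<^sup>2 / 2) at_top"
      by (intro tendsto_intros) auto
    then show ?thesis
    proof (rule Lim_transform_eventually)
      show "\<forall>\<^sub>F \<mu> in at_top. ((real (j \<mu>) - \<mu>) / sqrt \<mu>)\<^sup>2 / 2 = (real (j \<mu>) - \<mu>)\<^sup>2 / (2 * \<mu>)"
        using ev by eventually_elim (simp add: power_divide)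
    qed
  qed
  have "((\<lambda>\<mu>. (\<phi> \<mu> (k \<mu>) - \<phi> \<mu> (m \<mu>)) - (real (k \<mu>) - \<mu>)\<^sup>2 / (2 * \<mu>) + (real (m \<mu>) - \<mu>)\<^sup>2 / (2 * \<mu>))
      \<longlongrightarrow> 0 - x\<^sup>2 / 2 + 0\<^sup>2 / 2) at_top"
    using bounds by (intro tendsto_intros lim\<phi> close) auto
  then have "((\<lambda>\<mu>. exp (ln (poisson_prob \<mu> (k \<mu>)) - ln (poisson_prob \<mu> (m \<mu>)))) \<longlongrightarrow> exp (- (x\<^sup>2 / 2))) at_top"
    by (intro tendsto_exp) (simp add: \<phi>_def)
  then show ?thesis
  proof (rule Lim_transform_eventually)
    show "\<forall>\<^sub>F \<mu> in at_top. exp (ln (poisson_prob \<mu> (k \<mu>)) - ln (poisson_prob \<mu> (m \<mu>)))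
        = poisson_prob \<mu> (nat \<lfloor>\<mu> + sqrt \<mu> * x\<rfloor>) / poisson_prob \<mu> (nat \<lfloor>\<mu>\<rfloor>)"
      using ev by eventually_elim (simp add: exp_diff k_def m_def)
  qed
qed

section \<open>Power sums\<close>

text \<open>The step function for \<open>p\<^sub>i powr \<alpha>\<close>, rescaled with centre
  \<open>\<mu>\<close> and width \<open>sqrt \<mu>\<close> and normalized by the mode. One majorant
  \<open>w\<close>, independent of \<open>\<mu>\<close>, serves both claims: it makes
  \<open>F \<mu>\<close> integrable, hence the series convergent, and it permits dominated
  convergence.\<close>

lemma poisson_prob_powr_sums:
  assumes \<alpha>: "0 < \<alpha>"
  defines "F \<equiv> \<lambda>\<mu> x. if 0 \<le> \<mu> + sqrt \<mu> * x
             then (poisson_prob \<mu> (nat \<lfloor>\<mu> + sqrt \<mu> * x\<rfloor>) / poisson_prob \<mu> (nat \<lfloor>\<mu>\<rfloor>)) powr \<alpha> else 0"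
  shows "\<And>\<mu>. 4 \<le> \<mu> \<Longrightarrow> (\<lambda>k. poisson_prob \<mu> k powr \<alpha>) sums
           (poisson_prob \<mu> (nat \<lfloor>\<mu>\<rfloor>) powr \<alpha> * (sqrt \<mu> * (LINT x|lborel. F \<mu> x)))" (is "\<And>\<mu>. _ \<Longrightarrow> ?sums \<mu>")
    and "((\<lambda>\<mu>. LINT x|lborel. F \<mu> x) \<longlongrightarrow> sqrt (2 * pi / \<alpha>)) at_top"
proof -
  \<comment> \<open>The 5 is the 4 of \<open>poisson_prob_decay\<close> plus 1 for the rounding by
    the floor; the power \<open>\<alpha>\<close> then multiplies the whole exponent.\<close>
  define w where "w x = exp (5 * \<alpha>) * exp (- \<alpha> * \<bar>x\<bar>)" for x :: real
  have w: "integrable lborel w"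
    unfolding w_def by (intro integrable_mult_right integrable_exp_neg_abs \<alpha>)
  have [measurable]: "F \<mu> \<in> borel_measurable borel" for \<mu>
    unfolding F_def by measurable
  have bound: "norm (F \<mu> x) \<le> w x" if \<mu>: "4 \<le> \<mu>" for \<mu> x
  proof (cases "0 \<le> \<mu> + sqrt \<mu> * x")
    case True
    define k where "k = nat \<lfloor>\<mu> + sqrt \<mu> * x\<rfloor>"
    have s: "1 \<le> sqrt \<mu>"
      using \<mu> by simp
    have "\<bar>real k - (\<mu> + sqrt \<mu> * x)\<bar> \<le> 1"
      using True unfolding k_def by linarith
    then have "\<bar>sqrt \<mu> * x\<bar> - 1 * sqrt \<mu> \<le> \<bar>real k - \<mu>\<bar>"
      using s by linarith
    then have "(\<bar>sqrt \<mu> * x\<bar> - 1 * sqrt \<mu>) / sqrt \<mu> \<le> \<bar>real k - \<mu>\<bar> / sqrt \<mu>"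
      using \<mu> by (intro divide_right_mono) auto
    then have "\<bar>x\<bar> - 1 \<le> \<bar>real k - \<mu>\<bar> / sqrt \<mu>"
      using \<mu> by (simp add: diff_divide_distrib abs_mult)
    have "poisson_prob \<mu> k / poisson_prob \<mu> (nat \<lfloor>\<mu>\<rfloor>) \<le> exp (4 - \<bar>real k - \<mu>\<bar> / sqrt \<mu>)"
      using poisson_prob_decay[OF \<mu>, of k] \<mu> by (simp add: field_simps)
    also have "\<dots> \<le> exp (5 - \<bar>x\<bar>)"
      using \<open>\<bar>x\<bar> - 1 \<le> _\<close> by simp
    finally have "(poisson_prob \<mu> k / poisson_prob \<mu> (nat \<lfloor>\<mu>\<rfloor>)) powr \<alpha> \<le> exp (5 - \<bar>x\<bar>) powr \<alpha>"
      using \<alpha> by (intro powr_mono2) auto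
    also have "\<dots> = w x"
      by (simp add: w_def powr_def exp_add[symmetric] algebra_simps)
    finally show ?thesis
      using True by (simp add: F_def k_def)
  qed (simp add: F_def w_def)
  have int: "integrable lborel (F \<mu>)" if "4 \<le> \<mu>" for \<mu>
    using w by (rule Bochner_Integration.integrable_bound) (use bound[OF that] in \<open>auto simp: w_def\<close>)
  show "?sums \<mu>" if \<mu>: "4 \<le> \<mu>" for \<mu>
  proof -
    define m where "m = nat \<lfloor>\<mu>\<rfloor>"
    have m: "poisson_prob \<mu> m > 0"
      using \<mu> by simp
    have "(\<lambda>k. (poisson_prob \<mu> k / poisson_prob \<mu> m) powr \<alpha>) sums (sqrt \<mu> * (LINT x|lborel. F \<mu> x))"
      unfolding F_def m_def[symmetric]
      using \<mu> int[OF \<mu>, unfolded F_def, folded m_def] by (intro rescaled_floor_step_integral) auto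
    from sums_mult[OF this, of "poisson_prob \<mu> m powr \<alpha>"] show ?thesis
      using m by (simp add: powr_divide m_def)
  qed
  have "((\<lambda>\<mu>. LINT x|lborel. F \<mu> x) \<longlongrightarrow> (LINT x|lborel. exp (- (\<alpha> * x\<^sup>2 / 2)))) at_top"
  proof (rule integral_dominated_convergence_at_top[OF _ _ w])
    show "\<forall>\<^sub>F \<mu> in at_top. AE x in lborel. norm (F \<mu> x) \<le> w x"
      using eventually_ge_at_top[of 4] by eventually_elim (intro AE_I2 bound)
    show "AE x in lborel. ((\<lambda>\<mu>. F \<mu> x) \<longlongrightarrow> exp (- (\<alpha> * x\<^sup>2 / 2))) at_top"
    proof (rule AE_I2)
      fix x :: real
      have "((\<lambda>\<mu>. (poisson_prob \<mu> (nat \<lfloor>\<mu> + sqrt \<mu> * x\<rfloor>) / poisson_prob \<mu> (nat \<lfloor>\<mu>\<rfloor>)) powr \<alpha>)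
          \<longlongrightarrow> exp (- (x\<^sup>2 / 2)) powr \<alpha>) at_top"
        by (intro tendsto_powr poisson_prob_local_limit tendsto_const) simp
      moreover have "exp (- (x\<^sup>2 / 2)) powr \<alpha> = exp (- (\<alpha> * x\<^sup>2 / 2))"
        by (simp add: powr_def)
      \<comment> \<open>For fixed \<open>x\<close> the cutoff in \<open>F\<close> is eventually
        inactive.\<close>
      moreover have "\<forall>\<^sub>F \<mu> in at_top. 0 \<le> \<mu> + sqrt \<mu> * x"
        by real_asymp
      then have "\<forall>\<^sub>F \<mu> in at_top. (poisson_prob \<mu> (nat \<lfloor>\<mu> + sqrt \<mu> * x\<rfloor>) / poisson_prob \<mu> (nat \<lfloor>\<mu>\<rfloor>)) powr \<alpha> = F \<mu> x"
        by eventually_elim (simp add: F_def)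
      ultimately show "((\<lambda>\<mu>. F \<mu> x) \<longlongrightarrow> exp (- (\<alpha> * x\<^sup>2 / 2))) at_top"
        by (auto intro: Lim_transform_eventually)
    qed
  qed auto
  then show "((\<lambda>\<mu>. LINT x|lborel. F \<mu> x) \<longlongrightarrow> sqrt (2 * pi / \<alpha>)) at_top"
    using \<alpha> by (simp add: gaussian_integral)
qed

lemma summable_poisson_prob_powr:
  "0 < \<alpha> \<Longrightarrow> 4 \<le> \<mu> \<Longrightarrow> summable (\<lambda>k. poisson_prob \<mu> k powr \<alpha>)"
  using poisson_prob_powr_sums(1) by (rule sums_summable)

lemma poisson_prob_sums_1: "0 < \<mu> \<Longrightarrow> poisson_prob \<mu> sums 1"
  using exp_converges[of \<mu>, THEN sums_mult, of "exp (- \<mu>)"]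
  by (simp add: pmf_poisson field_simps exp_minus)

text \<open>With \<open>\<alpha> = 1\<close> the product of the mode probability,
  \<open>sqrt \<mu>\<close> and the integral equals 1, and the integral tends to
  \<open>sqrt (2 * pi)\<close>.\<close>

lemma poisson_prob_mode_asymp:
  "((\<lambda>\<mu>. poisson_prob \<mu> (nat \<lfloor>\<mu>\<rfloor>) * sqrt (2 * pi * \<mu>)) \<longlongrightarrow> 1) at_top"
proof -
  note * = poisson_prob_powr_sums[of 1, simplified]
  let ?I = "\<lambda>\<mu>. LINT x|lborel. (if 0 \<le> \<mu> + sqrt \<mu> * x
             then (poisson_prob \<mu> (nat \<lfloor>\<mu> + sqrt \<mu> * x\<rfloor>) / poisson_prob \<mu> (nat \<lfloor>\<mu>\<rfloor>)) powr 1 else 0)"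
  have "((\<lambda>\<mu>. sqrt (2 * pi) / ?I \<mu>) \<longlongrightarrow> sqrt (2 * pi) / sqrt (2 * pi)) at_top"
    by (rule tendsto_divide[OF tendsto_const *(2)]) simp
  moreover have "\<forall>\<^sub>F \<mu> in at_top. sqrt (2 * pi) / ?I \<mu> = poisson_prob \<mu> (nat \<lfloor>\<mu>\<rfloor>) * sqrt (2 * pi * \<mu>)"
    using eventually_ge_at_top[of 4]
  proof eventually_elim
    case (elim \<mu>)
    have "poisson_prob \<mu> (nat \<lfloor>\<mu>\<rfloor>) * (sqrt \<mu> * ?I \<mu>) = 1"
      using *(1)[OF elim] poisson_prob_sums_1[of \<mu>] elim by (auto intro: sums_unique2)
    \<comment> \<open>A vanishing integral would contradict the product being 1.\<close>
    then show ?case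
      by (cases "?I \<mu> = 0") (auto simp: field_simps real_sqrt_mult)
  qed
  ultimately show ?thesis
    by (auto intro: Lim_transform_eventually)
qed

definition poisson_power_sum :: "real \<Rightarrow> real \<Rightarrow> real" where
  "poisson_power_sum \<alpha> \<mu> = (\<Sum>i. poisson_prob \<mu> i powr \<alpha>)"

text \<open>Dividing by the power of \<open>2 * pi * \<mu>\<close> regroups the sum into the
  normalized mode probability to the power \<open>\<alpha>\<close>, which tends to 1, times a ratio
  of Gaussian integrals.\<close>

lemma poisson_power_sum_asymp:
  assumes \<alpha>: "0 < \<alpha>"
  shows "((\<lambda>\<mu>. poisson_power_sum \<alpha> \<mu> / (2 * pi * \<mu>) powr ((1 - \<alpha>) / 2)) \<longlongrightarrow> 1 / sqrt \<alpha>) at_top"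
proof -
  let ?I = "\<lambda>\<mu>. LINT x|lborel. (if 0 \<le> \<mu> + sqrt \<mu> * x
             then (poisson_prob \<mu> (nat \<lfloor>\<mu> + sqrt \<mu> * x\<rfloor>) / poisson_prob \<mu> (nat \<lfloor>\<mu>\<rfloor>)) powr \<alpha> else 0)"
  have "((\<lambda>\<mu>. (poisson_prob \<mu> (nat \<lfloor>\<mu>\<rfloor>) * sqrt (2 * pi * \<mu>)) powr \<alpha> * (?I \<mu> / sqrt (2 * pi)))
      \<longlongrightarrow> 1 powr \<alpha> * (sqrt (2 * pi / \<alpha>) / sqrt (2 * pi))) at_top"
    by (intro tendsto_intros poisson_prob_mode_asymp poisson_prob_powr_sums(2) \<alpha>) simp_all
  moreover have "1 powr \<alpha> * (sqrt (2 * pi / \<alpha>) / sqrt (2 * pi)) = 1 / sqrt \<alpha>"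
    by (simp add: real_sqrt_divide)
  moreover have "\<forall>\<^sub>F \<mu> in at_top. (poisson_prob \<mu> (nat \<lfloor>\<mu>\<rfloor>) * sqrt (2 * pi * \<mu>)) powr \<alpha> * (?I \<mu> / sqrt (2 * pi))
      = poisson_power_sum \<alpha> \<mu> / (2 * pi * \<mu>) powr ((1 - \<alpha>) / 2)"
    using eventually_ge_at_top[of 4]
  proof eventually_elim
    case (elim \<mu>)
    have S: "poisson_power_sum \<alpha> \<mu> = poisson_prob \<mu> (nat \<lfloor>\<mu>\<rfloor>) powr \<alpha> * (sqrt \<mu> * ?I \<mu>)"
      unfolding poisson_power_sum_def using poisson_prob_powr_sums(1)[OF \<alpha> elim] by (rule sums_unique[symmetric])
    have "(2 * pi * \<mu>) powr ((1 - \<alpha>) / 2) = sqrt (2 * pi * \<mu>) powr (1 - \<alpha>)"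
      using elim by (simp add: powr_half_sqrt[symmetric] powr_powr)
    also have "\<dots> = sqrt (2 * pi * \<mu>) / sqrt (2 * pi * \<mu>) powr \<alpha>"
      using elim by (simp add: powr_diff)
    finally have D: "(2 * pi * \<mu>) powr ((1 - \<alpha>) / 2) = sqrt (2 * pi) * sqrt \<mu> / sqrt (2 * pi * \<mu>) powr \<alpha>"
      by (simp add: real_sqrt_mult)
    show ?case
      unfolding S D using elim by (simp add: powr_mult field_simps)
  qed
  ultimately show ?thesis
    by (auto intro: Lim_transform_eventually)
qed

section \<open>Entropies\<close>

lemma poisson_power_sum_pos:
  assumes "0 < \<alpha>" "4 \<le> \<mu>"
  shows "0 < poisson_power_sum \<alpha> \<mu>"
  unfolding poisson_power_sum_def
  using assms by (intro suminf_pos summable_poisson_prob_powr) auto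

lemma poisson_power_sum_1: "0 < \<mu> \<Longrightarrow> poisson_power_sum 1 \<mu> = 1"
  using poisson_prob_sums_1[of \<mu>] by (simp add: poisson_power_sum_def sums_iff)

text \<open>In logarithmic form the error is additive and tends to 0, so the constant term is pinned
  down.\<close>

lemma ln_poisson_power_sum_asymp:
  assumes \<alpha>: "0 < \<alpha>"
  shows "((\<lambda>\<mu>. ln (poisson_power_sum \<alpha> \<mu>) - (1 - \<alpha>) / 2 * ln (2 * pi * \<mu>)) \<longlongrightarrow> - ln \<alpha> / 2) at_top"
proof -
  have "((\<lambda>\<mu>. ln (poisson_power_sum \<alpha> \<mu> / (2 * pi * \<mu>) powr ((1 - \<alpha>) / 2))) \<longlongrightarrow> ln (1 / sqrt \<alpha>)) at_top"
    using \<alpha> by (intro tendsto_ln poisson_power_sum_asymp) auto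
  moreover have "ln (1 / sqrt \<alpha>) = - ln \<alpha> / 2"
    using \<alpha> by (simp add: ln_div ln_sqrt)
  moreover have "\<forall>\<^sub>F \<mu> in at_top. ln (poisson_power_sum \<alpha> \<mu> / (2 * pi * \<mu>) powr ((1 - \<alpha>) / 2))
      = ln (poisson_power_sum \<alpha> \<mu>) - (1 - \<alpha>) / 2 * ln (2 * pi * \<mu>)"
    using eventually_ge_at_top[of 4]
    by eventually_elim (use poisson_power_sum_pos[OF \<alpha>] in \<open>simp add: ln_div ln_powr less_imp_neq[symmetric]\<close>)
  ultimately show ?thesis
    by (auto intro: Lim_transform_eventually)
qed

text \<open>A bounded difference is negligible against a function that diverges.\<close>

lemma asymp_equiv_at_top_if_diff_tendsto:
  fixes f g :: "'a \<Rightarrow> real"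
  assumes "((\<lambda>x. f x - g x) \<longlongrightarrow> c) F" and "filterlim g at_top F"
  shows "f \<sim>[F] g"
proof (rule smallo_imp_asymp_equiv)
  have "(\<lambda>x. f x - g x) \<in> O[F](\<lambda>_. 1)"
    using assms(1) by (intro bigoI_tendsto[of _ _ c]) auto
  also have "(\<lambda>_. 1) \<in> o[F](g)"
  proof (rule smalloI_tendsto)
    show "((\<lambda>x. 1 / g x) \<longlongrightarrow> 0) F"
      by (rule tendsto_divide_0[OF tendsto_const filterlim_at_top_imp_at_infinity[OF assms(2)]])
    have "\<forall>\<^sub>F x in F. 0 < g x"
      using assms(2) by (simp add: filterlim_at_top_dense)
    then show "\<forall>\<^sub>F x in F. g x \<noteq> 0"
      by eventually_elim simp
  qed
  finally show "(\<lambda>x. f x - g x) \<in> o[F](g)" .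
qed

section \<open>Two-parameter generalized Renyi entropy and Renyi entropy\<close>

text \<open>The entropy is a difference quotient of logarithmic power sums; the coefficients
  \<open>(1 - \<alpha>) / 2\<close> and \<open>(1 - \<beta>) / 2\<close> of the logarithm differ by
  \<open>(\<beta> - \<alpha>) / 2\<close>, which leaves \<open>1 / 2\<close>.\<close>

lemma gen_renyi_entropy2_expansion:
  assumes "0 < \<alpha>" "0 < \<beta>" "\<alpha> \<noteq> \<beta>"
  shows "((\<lambda>\<mu>. gen_renyi_entropy2 \<alpha> \<beta> \<mu> - (1 / 2 * ln (2 * pi * \<mu>) + (ln \<beta> - ln \<alpha>) / (2 * (\<beta> - \<alpha>)))) \<longlongrightarrow> 0) at_top"
proof -
  let ?D = "\<lambda>\<alpha> \<mu>. ln (poisson_power_sum \<alpha> \<mu>) - (1 - \<alpha>) / 2 * ln (2 * pi * \<mu>)"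
  have "((\<lambda>\<mu>. 1 / (\<beta> - \<alpha>) * (?D \<alpha> \<mu> - ?D \<beta> \<mu>) - (ln \<beta> - ln \<alpha>) / (2 * (\<beta> - \<alpha>)))
      \<longlongrightarrow> 1 / (\<beta> - \<alpha>) * (- ln \<alpha> / 2 - (- ln \<beta> / 2)) - (ln \<beta> - ln \<alpha>) / (2 * (\<beta> - \<alpha>))) at_top"
    by (intro tendsto_intros ln_poisson_power_sum_asymp assms)
  moreover have "1 / (\<beta> - \<alpha>) * (- ln \<alpha> / 2 - (- ln \<beta> / 2)) - (ln \<beta> - ln \<alpha>) / (2 * (\<beta> - \<alpha>)) = 0"
    using assms by (simp add: field_simps)
  moreover have "\<forall>\<^sub>F \<mu> in at_top. 1 / (\<beta> - \<alpha>) * (?D \<alpha> \<mu> - ?D \<beta> \<mu>) - (ln \<beta> - ln \<alpha>) / (2 * (\<beta> - \<alpha>))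
     = gen_renyi_entropy2 \<alpha> \<beta> \<mu> - (1 / 2 * ln (2 * pi * \<mu>) + (ln \<beta> - ln \<alpha>) / (2 * (\<beta> - \<alpha>)))"
    using eventually_ge_at_top[of 4]
  proof eventually_elim
    case (elim \<mu>)
    have "gen_renyi_entropy2 \<alpha> \<beta> \<mu> = 1 / (\<beta> - \<alpha>) * (ln (poisson_power_sum \<alpha> \<mu>) - ln (poisson_power_sum \<beta> \<mu>))"
      using assms elim poisson_power_sum_pos[of \<alpha> \<mu>] poisson_power_sum_pos[of \<beta> \<mu>]
      by (simp add: gen_renyi_entropy2_def poisson_power_sum_def[symmetric] ln_div)
    moreover have "1 / (\<beta> - \<alpha>) * (?D \<alpha> \<mu> - ?D \<beta> \<mu>)
        = 1 / (\<beta> - \<alpha>) * (ln (poisson_power_sum \<alpha> \<mu>) - ln (poisson_power_sum \<beta> \<mu>)) - 1 / 2 * ln (2 * pi * \<mu>)"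
    proof -
      have "?D \<alpha> \<mu> - ?D \<beta> \<mu> = (ln (poisson_power_sum \<alpha> \<mu>) - ln (poisson_power_sum \<beta> \<mu>)) - (\<beta> - \<alpha>) * (1 / 2 * ln (2 * pi * \<mu>))"
        by (simp add: algebra_simps diff_divide_distrib)
      then show ?thesis
        using assms(3) by (simp only: right_diff_distrib) simp
    qed
    ultimately show ?case by simp
  qed
  ultimately show ?thesis
    by (auto intro: Lim_transform_eventually)
qed

lemma half_ln_plus_const_at_top: "filterlim (\<lambda>\<mu>. 1 / 2 * ln (2 * pi * \<mu>) + c) at_top at_top"
  by real_asymp

lemma gen_renyi_entropy2_asymp_equiv:
  assumes "0 < \<alpha>" "0 < \<beta>" "\<alpha> \<noteq> \<beta>"
  shows "gen_renyi_entropy2 \<alpha> \<beta> \<sim>[at_top] (\<lambda>\<mu>. 1 / 2 * ln (2 * pi * \<mu>) + (ln \<beta> - ln \<alpha>) / (2 * (\<beta> - \<alpha>)))"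
  using gen_renyi_entropy2_expansion[OF assms] half_ln_plus_const_at_top
  by (rule asymp_equiv_at_top_if_diff_tendsto)

text \<open>Asymptotic equivalence does not see an additive constant beside a diverging logarithm.
  The free \<open>c\<close> lets entropies with different parameters be compared with one
  function.\<close>

lemma gen_renyi_entropy2_asymp_equiv_const:
  assumes "0 < \<alpha>" "0 < \<beta>" "\<alpha> \<noteq> \<beta>"
  shows "gen_renyi_entropy2 \<alpha> \<beta> \<sim>[at_top] (\<lambda>\<mu>. 1 / 2 * ln (2 * pi * \<mu>) + c)"
proof (rule asymp_equiv_at_top_if_diff_tendsto)
  show "((\<lambda>\<mu>. gen_renyi_entropy2 \<alpha> \<beta> \<mu> - (1 / 2 * ln (2 * pi * \<mu>) + c)) \<longlongrightarrow> 0 + ((ln \<beta> - ln \<alpha>) / (2 * (\<beta> - \<alpha>)) - c)) at_top"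
    using tendsto_add[OF gen_renyi_entropy2_expansion[OF assms] tendsto_const[of "(ln \<beta> - ln \<alpha>) / (2 * (\<beta> - \<alpha>)) - c"]]
    by (simp add: algebra_simps)
qed (rule half_ln_plus_const_at_top)

lemma gen_renyi_entropy2_at_top:
  assumes "0 < \<alpha>" "0 < \<beta>" "\<alpha> \<noteq> \<beta>"
  shows "filterlim (gen_renyi_entropy2 \<alpha> \<beta>) at_top at_top"
  using gen_renyi_entropy2_asymp_equiv[OF assms] half_ln_plus_const_at_top
  by (meson asymp_equiv_at_top_transfer asymp_equiv_symI)

text \<open>For \<open>\<beta> = 1\<close> the denominator is the total mass 1.\<close>

lemma renyi_entropy_eq_gen_renyi_entropy2: "0 < \<mu> \<Longrightarrow> renyi_entropy \<alpha> \<mu> = gen_renyi_entropy2 \<alpha> 1 \<mu>"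
  using poisson_power_sum_1[of \<mu>]
  by (simp add: renyi_entropy_def gen_renyi_entropy2_def poisson_power_sum_def)

section \<open>One-parameter generalized Renyi entropy and Shannon entropy\<close>

text \<open>Half of the exponent pays for the logarithm: \<open>- ln p\<close> is at most
  \<open>2 / \<alpha> * p powr - (\<alpha> / 2)\<close>, and the remaining power
  \<open>\<alpha> / 2\<close> is summable.\<close>

lemma summable_poisson_prob_powr_ln:
  assumes \<alpha>: "0 < \<alpha>" and \<mu>: "4 \<le> \<mu>"
  shows "summable (\<lambda>k. poisson_prob \<mu> k powr \<alpha> * ln (poisson_prob \<mu> k))"
proof (rule summable_comparison_test')
  show "summable (\<lambda>k. 2 / \<alpha> * poisson_prob \<mu> k powr (\<alpha> / 2))"
    using assms by (intro summable_mult summable_poisson_prob_powr) auto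
  fix k :: nat
  let ?p = "poisson_prob \<mu> k"
  have p: "0 < ?p" "?p \<le> 1"
    using \<mu> by (simp_all add: pmf_le_1)
  have "ln (?p powr - (\<alpha> / 2)) \<le> ?p powr - (\<alpha> / 2)"
    using p by (intro less_imp_le ln_less_self) auto
  then have "- ln ?p \<le> 2 / \<alpha> * ?p powr - (\<alpha> / 2)"
    using p \<alpha> by (simp add: ln_powr field_simps)
  then have "?p powr \<alpha> * - ln ?p \<le> ?p powr \<alpha> * (2 / \<alpha> * ?p powr - (\<alpha> / 2))"
    by (intro mult_left_mono) auto
  also have "\<dots> = 2 / \<alpha> * ?p powr (\<alpha> / 2)"
    using powr_add[of ?p \<alpha> "- (\<alpha> / 2)"] by simp
  finally show "norm (?p powr \<alpha> * ln ?p) \<le> 2 / \<alpha> * ?p powr (\<alpha> / 2)"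
    using p by (simp add: abs_mult)
qed

text \<open>Jensen's inequality for weights proportional to \<open>p\<^sub>i powr \<alpha>\<close>.\<close>

lemma ln_poisson_power_sum_ratio_ge:
  assumes \<alpha>: "0 < \<alpha>" and h: "0 < \<alpha> + h" and \<mu>: "4 \<le> \<mu>"
  shows "- h * gen_renyi_entropy1 \<alpha> \<mu> \<le> ln (poisson_power_sum (\<alpha> + h) \<mu> / poisson_power_sum \<alpha> \<mu>)"
proof -
  define S where "S = poisson_power_sum \<alpha> \<mu>"
  define L where "L = (\<Sum>k. poisson_prob \<mu> k powr \<alpha> * ln (poisson_prob \<mu> k))"
  \<comment> \<open>The weighted mean of \<open>ln p\<close>, which is minus the entropy.\<close>
  define M where "M = L / S"
  have S: "0 < S" and T: "0 < poisson_power_sum (\<alpha> + h) \<mu>"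
    using poisson_power_sum_pos \<alpha> h \<mu> by (auto simp: S_def)
  have "(\<lambda>k. poisson_prob \<mu> k powr \<alpha>) sums S"
    unfolding S_def poisson_power_sum_def using \<alpha> \<mu> by (intro summable_sums summable_poisson_prob_powr)
  moreover have "(\<lambda>k. poisson_prob \<mu> k powr \<alpha> * ln (poisson_prob \<mu> k)) sums L"
    unfolding L_def using \<alpha> \<mu> by (intro summable_sums summable_poisson_prob_powr_ln)
  \<comment> \<open>The terms are \<open>p powr (\<alpha> + h)\<close> with the exponential in
    \<open>h * ln p\<close> replaced by its tangent line at \<open>h * M\<close>, a lower bound by
    convexity.\<close>
  ultimately have "(\<lambda>k. exp (h * M) * ((1 - h * M) * poisson_prob \<mu> k powr \<alpha>
      + h * (poisson_prob \<mu> k powr \<alpha> * ln (poisson_prob \<mu> k)))) sums (exp (h * M) * ((1 - h * M) * S + h * L))"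
    by (intro sums_mult sums_add)
  moreover have "(\<lambda>k. poisson_prob \<mu> k powr (\<alpha> + h)) sums poisson_power_sum (\<alpha> + h) \<mu>"
    unfolding poisson_power_sum_def using h \<mu> by (intro summable_sums summable_poisson_prob_powr)
  ultimately have "exp (h * M) * ((1 - h * M) * S + h * L) \<le> poisson_power_sum (\<alpha> + h) \<mu>"
  proof (rule sums_le[rotated])
    fix k
    let ?p = "poisson_prob \<mu> k"
    have "exp (h * M) * ((1 - h * M) * ?p powr \<alpha> + h * (?p powr \<alpha> * ln ?p))
        = ?p powr \<alpha> * exp (h * M) * (1 + h * (ln ?p - M))"
      by (simp add: algebra_simps)
    also have "\<dots> \<le> ?p powr \<alpha> * exp (h * M) * exp (h * (ln ?p - M))"
      by (intro mult_left_mono exp_ge_add_one_self) auto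
    also have "\<dots> = ?p powr (\<alpha> + h)"
      using \<mu> by (simp add: powr_def exp_add[symmetric] algebra_simps)
    finally show "exp (h * M) * ((1 - h * M) * ?p powr \<alpha> + h * (?p powr \<alpha> * ln ?p)) \<le> ?p powr (\<alpha> + h)" .
  qed
  \<comment> \<open>The linear part cancels because the tangent was taken at the mean:
    \<open>L = M * S\<close>.\<close>
  also have "(1 - h * M) * S + h * L = S"
    using S by (simp add: M_def algebra_simps)
  finally have "exp (h * M) \<le> poisson_power_sum (\<alpha> + h) \<mu> / S"
    using S by (simp add: field_simps)
  then have "h * M \<le> ln (poisson_power_sum (\<alpha> + h) \<mu> / S)"
    using S T by (subst ln_ge_iff) auto
  moreover have "gen_renyi_entropy1 \<alpha> \<mu> = - M"
    by (simp add: gen_renyi_entropy1_def M_def L_def S_def poisson_power_sum_def)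
  ultimately show ?thesis
    by (simp add: S_def)
qed

text \<open>The preceding inequality with \<open>h = \<alpha>\<close> and with
  \<open>h = - (\<alpha> / 2)\<close>; the opposite signs of \<open>h\<close> give bounds in
  opposite directions, and both choices keep \<open>\<alpha> + h\<close> positive.\<close>

lemma gen_renyi_entropy1_bounds:
  assumes \<alpha>: "0 < \<alpha>" and \<mu>: "4 \<le> \<mu>"
  shows "gen_renyi_entropy2 \<alpha> (2 * \<alpha>) \<mu> \<le> gen_renyi_entropy1 \<alpha> \<mu>"
    and "gen_renyi_entropy1 \<alpha> \<mu> \<le> gen_renyi_entropy2 (\<alpha> / 2) \<alpha> \<mu>"
proof -
  have S: "0 < poisson_power_sum a \<mu>" if "0 < a" for a
    using poisson_power_sum_pos that \<mu> by simp
  show "gen_renyi_entropy2 \<alpha> (2 * \<alpha>) \<mu> \<le> gen_renyi_entropy1 \<alpha> \<mu>"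
    using ln_poisson_power_sum_ratio_ge[of \<alpha> \<alpha> \<mu>] \<alpha> \<mu> S[of \<alpha>] S[of "2 * \<alpha>"]
    by (simp add: gen_renyi_entropy2_def poisson_power_sum_def[symmetric] ln_div field_simps)
  show "gen_renyi_entropy1 \<alpha> \<mu> \<le> gen_renyi_entropy2 (\<alpha> / 2) \<alpha> \<mu>"
    using ln_poisson_power_sum_ratio_ge[of \<alpha> "- (\<alpha> / 2)" \<mu>] \<alpha> \<mu>
    by (simp add: gen_renyi_entropy2_def poisson_power_sum_def[symmetric] field_simps)
qed

lemma gen_renyi_entropy1_at_top:
  assumes "0 < \<alpha>"
  shows "filterlim (gen_renyi_entropy1 \<alpha>) at_top at_top"
proof (rule filterlim_at_top_mono)
  show "filterlim (gen_renyi_entropy2 \<alpha> (2 * \<alpha>)) at_top at_top"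
    using assms by (intro gen_renyi_entropy2_at_top) auto
  show "\<forall>\<^sub>F \<mu> in at_top. gen_renyi_entropy2 \<alpha> (2 * \<alpha>) \<mu> \<le> gen_renyi_entropy1 \<alpha> \<mu>"
    using eventually_ge_at_top[of 4] by eventually_elim (rule gen_renyi_entropy1_bounds[OF assms])
qed

text \<open>The two bounds have different limiting constants, but both are equivalent to the
  logarithm with any constant \<open>c\<close>, so the sandwich closes.\<close>

lemma gen_renyi_entropy1_asymp_equiv:
  assumes "0 < \<alpha>"
  shows "gen_renyi_entropy1 \<alpha> \<sim>[at_top] (\<lambda>\<mu>. 1 / 2 * ln (2 * pi * \<mu>) + c)"
proof (rule asymp_equiv_sandwich_real)
  show "\<forall>\<^sub>F \<mu> in at_top. gen_renyi_entropy1 \<alpha> \<mu> \<in> {gen_renyi_entropy2 \<alpha> (2 * \<alpha>) \<mu> .. gen_renyi_entropy2 (\<alpha> / 2) \<alpha> \<mu>}"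
    using eventually_ge_at_top[of 4]
    by eventually_elim (simp add: gen_renyi_entropy1_bounds[OF assms])
qed (rule gen_renyi_entropy2_asymp_equiv_const; use assms in simp)+

text \<open>For \<open>\<alpha> = 1\<close> the weights are the probabilities themselves and the
  denominator is 1.\<close>

lemma shannon_entropy_eq_gen_renyi_entropy1: "0 < \<mu> \<Longrightarrow> shannon_entropy \<mu> = gen_renyi_entropy1 1 \<mu>"
  using poisson_power_sum_1[of \<mu>]
  by (simp add: shannon_entropy_def gen_renyi_entropy1_def poisson_power_sum_def)

section \<open>Sharma-Mittal and Tsallis entropies\<close>

text \<open>Raising the asymptotics of the power sum to the power
  \<open>(1 - \<beta>) / (1 - \<alpha>)\<close> turns the exponent \<open>(1 - \<alpha>) / 2\<close>
  into \<open>(1 - \<beta>) / 2\<close>, whatever the sign of \<open>1 - \<beta>\<close>.\<close>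

lemma sharma_mittal_power_asymp:
  assumes \<alpha>: "0 < \<alpha>" "\<alpha> \<noteq> 1"
  shows "((\<lambda>\<mu>. poisson_power_sum \<alpha> \<mu> powr ((1 - \<beta>) / (1 - \<alpha>)) / (2 * pi * \<mu>) powr ((1 - \<beta>) / 2))
           \<longlongrightarrow> 1 / \<alpha> powr ((1 - \<beta>) / (2 * (1 - \<alpha>)))) at_top"
proof -
  have "((\<lambda>\<mu>. (poisson_power_sum \<alpha> \<mu> / (2 * pi * \<mu>) powr ((1 - \<alpha>) / 2)) powr ((1 - \<beta>) / (1 - \<alpha>)))
      \<longlongrightarrow> (1 / sqrt \<alpha>) powr ((1 - \<beta>) / (1 - \<alpha>))) at_top"
    using \<alpha> by (intro tendsto_powr poisson_power_sum_asymp tendsto_const) auto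
  moreover have "(1 / sqrt \<alpha>) powr ((1 - \<beta>) / (1 - \<alpha>)) = 1 / \<alpha> powr ((1 - \<beta>) / (2 * (1 - \<alpha>)))"
    using \<alpha> by (simp add: powr_divide powr_half_sqrt[symmetric] powr_powr)
  moreover have "\<forall>\<^sub>F \<mu> in at_top. (poisson_power_sum \<alpha> \<mu> / (2 * pi * \<mu>) powr ((1 - \<alpha>) / 2)) powr ((1 - \<beta>) / (1 - \<alpha>))
      = poisson_power_sum \<alpha> \<mu> powr ((1 - \<beta>) / (1 - \<alpha>)) / (2 * pi * \<mu>) powr ((1 - \<beta>) / 2)"
    using eventually_ge_at_top[of 4]
  proof eventually_elim
    case (elim \<mu>)
    have "(1 - \<alpha>) / 2 * ((1 - \<beta>) / (1 - \<alpha>)) = (1 - \<beta>) / 2"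
      using \<alpha> by (simp add: field_simps)
    then show ?case
      using poisson_power_sum_pos[OF \<alpha>(1) elim] by (simp only: powr_divide powr_powr less_imp_le powr_ge_zero)
  qed
  ultimately show ?thesis
    by (auto intro: Lim_transform_eventually)
qed

text \<open>For \<open>\<beta> < 1\<close> the power of \<open>2 * pi * \<mu>\<close> diverges, so
  the subtracted 1 is negligible against it.\<close>

lemma sharma_mittal_entropy_asymp_equiv:
  assumes \<alpha>: "0 < \<alpha>" "\<alpha> \<noteq> 1" and \<beta>: "\<beta> < 1"
  shows "sharma_mittal_entropy \<alpha> \<beta> \<sim>[at_top]
           (\<lambda>\<mu>. 1 / ((1 - \<beta>) * \<alpha> powr ((1 - \<beta>) / (2 * (1 - \<alpha>)))) * (2 * pi * \<mu>) powr ((1 - \<beta>) / 2))"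
proof (rule asymp_equivI'_const)
  let ?X = "\<lambda>\<mu>. (2 * pi * \<mu>) powr ((1 - \<beta>) / 2)"
  have "((\<lambda>\<mu>. 1 / ?X \<mu>) \<longlongrightarrow> 0) at_top"
    using \<beta> by real_asymp
  then have "((\<lambda>\<mu>. 1 / (1 - \<beta>) * (poisson_power_sum \<alpha> \<mu> powr ((1 - \<beta>) / (1 - \<alpha>)) / ?X \<mu> - 1 / ?X \<mu>))
      \<longlongrightarrow> 1 / (1 - \<beta>) * (1 / \<alpha> powr ((1 - \<beta>) / (2 * (1 - \<alpha>))) - 0)) at_top"
    by (intro tendsto_intros sharma_mittal_power_asymp \<alpha>)
  then show "((\<lambda>\<mu>. sharma_mittal_entropy \<alpha> \<beta> \<mu> / ?X \<mu>)
      \<longlongrightarrow> 1 / ((1 - \<beta>) * \<alpha> powr ((1 - \<beta>) / (2 * (1 - \<alpha>))))) at_top"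
    by (simp only: sharma_mittal_entropy_def poisson_power_sum_def diff_divide_distrib[symmetric] times_divide_eq_right
          diff_zero divide_divide_eq_left mult_1_right mult.commute[of "1 - \<beta>"])
qed (use \<alpha> \<beta> in simp)

lemma sharma_mittal_entropy_at_top:
  assumes \<alpha>: "0 < \<alpha>" "\<alpha> \<noteq> 1" and \<beta>: "\<beta> < 1"
  shows "filterlim (sharma_mittal_entropy \<alpha> \<beta>) at_top at_top"
proof (rule asymp_equiv_at_top_transfer[OF asymp_equiv_symI[OF sharma_mittal_entropy_asymp_equiv[OF assms]]])
  have "filterlim (\<lambda>\<mu>. (2 * pi * \<mu>) powr ((1 - \<beta>) / 2)) at_top at_top"
    using \<beta> by real_asymp
  then show "filterlim (\<lambda>\<mu>. 1 / ((1 - \<beta>) * \<alpha> powr ((1 - \<beta>) / (2 * (1 - \<alpha>)))) * (2 * pi * \<mu>) powr ((1 - \<beta>) / 2)) at_top at_top"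
    using \<alpha> \<beta> by (intro filterlim_tendsto_pos_mult_at_top[OF tendsto_const]) auto
qed

text \<open>For \<open>\<beta> > 1\<close> the power of \<open>2 * pi * \<mu>\<close> tends to 0, so
  only the subtracted 1 survives.\<close>

lemma sharma_mittal_entropy_tendsto:
  assumes \<alpha>: "0 < \<alpha>" "\<alpha> \<noteq> 1" and \<beta>: "1 < \<beta>"
  shows "(sharma_mittal_entropy \<alpha> \<beta> \<longlongrightarrow> 1 / (\<beta> - 1)) at_top"
proof -
  let ?X = "\<lambda>\<mu>. (2 * pi * \<mu>) powr ((1 - \<beta>) / 2)"
  let ?W = "\<lambda>\<mu>. poisson_power_sum \<alpha> \<mu> powr ((1 - \<beta>) / (1 - \<alpha>))"
  have "(?X \<longlongrightarrow> 0) at_top"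
    using \<beta> by real_asymp
  from tendsto_mult[OF sharma_mittal_power_asymp[OF \<alpha>] this, of \<beta>]
  have "((\<lambda>\<mu>. ?W \<mu> / ?X \<mu> * ?X \<mu>) \<longlongrightarrow> 0) at_top"
    by simp
  moreover have "\<forall>\<^sub>F \<mu> in at_top. ?W \<mu> / ?X \<mu> * ?X \<mu> = ?W \<mu>"
    using eventually_gt_at_top[of 0] by eventually_elim simp
  ultimately have "(?W \<longlongrightarrow> 0) at_top"
    by (rule Lim_transform_eventually)
  then have "((\<lambda>\<mu>. 1 / (1 - \<beta>) * (?W \<mu> - 1)) \<longlongrightarrow> 1 / (1 - \<beta>) * (0 - 1)) at_top"
    by (intro tendsto_intros)
  moreover have "1 / (1 - \<beta>) * (0 - 1) = 1 / (\<beta> - 1)"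
    using \<beta> by (simp add: field_simps)
  moreover have "sharma_mittal_entropy \<alpha> \<beta> = (\<lambda>\<mu>. 1 / (1 - \<beta>) * (?W \<mu> - 1))"
    by (rule ext) (simp add: sharma_mittal_entropy_def poisson_power_sum_def)
  ultimately show ?thesis
    by simp
qed

text \<open>The remaining range is \<open>\<beta> > 1\<close>, where a finite limit excludes
  divergence.\<close>

lemma sharma_mittal_entropy_at_top_iff:
  assumes "0 < \<alpha>" "\<alpha> \<noteq> 1" "\<beta> \<noteq> 1"
  shows "filterlim (sharma_mittal_entropy \<alpha> \<beta>) at_top at_top \<longleftrightarrow> \<beta> < 1"
proof
  assume lim: "filterlim (sharma_mittal_entropy \<alpha> \<beta>) at_top at_top"
  show "\<beta> < 1"
  proof (rule ccontr)
    assume "\<not> \<beta> < 1"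
    then have "(sharma_mittal_entropy \<alpha> \<beta> \<longlongrightarrow> 1 / (\<beta> - 1)) at_top"
      using assms by (intro sharma_mittal_entropy_tendsto) auto
    then show False
      using not_tendsto_and_filterlim_at_infinity[OF _ _ filterlim_at_top_imp_at_infinity[OF lim]]
      by auto
  qed
qed (use assms sharma_mittal_entropy_at_top in blast)

text \<open>For \<open>\<beta> = \<alpha>\<close> the outer exponent is 1, and \<open>powr 1\<close>
  is the identity on the positive power sum.\<close>

lemma eventually_tsallis_entropy_eq_sharma_mittal_entropy:
  assumes \<alpha>: "0 < \<alpha>" "\<alpha> \<noteq> 1"
  shows "\<forall>\<^sub>F \<mu> in at_top. tsallis_entropy \<alpha> \<mu> = sharma_mittal_entropy \<alpha> \<alpha> \<mu>"
  using eventually_ge_at_top[of 4]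
proof eventually_elim
  case (elim \<mu>)
  then show ?case
    using poisson_power_sum_pos[of \<alpha> \<mu>] \<alpha>
    by (simp add: tsallis_entropy_def sharma_mittal_entropy_def poisson_power_sum_def[symmetric])
qed

lemma tsallis_entropy_asymp_equiv:
  assumes "0 < \<alpha>" "\<alpha> < 1"
  shows "tsallis_entropy \<alpha> \<sim>[at_top] (\<lambda>\<mu>. 1 / (sqrt \<alpha> * (1 - \<alpha>)) * (2 * pi * \<mu>) powr ((1 - \<alpha>) / 2))"
proof -
  have "sharma_mittal_entropy \<alpha> \<alpha> \<sim>[at_top] (\<lambda>\<mu>. 1 / (sqrt \<alpha> * (1 - \<alpha>)) * (2 * pi * \<mu>) powr ((1 - \<alpha>) / 2))"
  proof -
    have "(1 - \<alpha>) / (2 * (1 - \<alpha>)) = 1 / 2"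
      using assms by simp
    then have "(1 - \<alpha>) * \<alpha> powr ((1 - \<alpha>) / (2 * (1 - \<alpha>))) = sqrt \<alpha> * (1 - \<alpha>)"
      using assms by (simp only: powr_half_sqrt mult.commute)
    then show ?thesis
      using sharma_mittal_entropy_asymp_equiv[of \<alpha> \<alpha>] assms by (simp only:)
  qed
  then show ?thesis
    using assms
    by (subst asymp_equiv_cong[OF eventually_tsallis_entropy_eq_sharma_mittal_entropy always_eventually]) auto
qed

lemma eventually_shannon_entropy_eq_gen_renyi_entropy1:
  "\<forall>\<^sub>F \<mu> in at_top. shannon_entropy \<mu> = gen_renyi_entropy1 1 \<mu>"
  using eventually_gt_at_top[of 0] by eventually_elim (rule shannon_entropy_eq_gen_renyi_entropy1)

lemma eventually_renyi_entropy_eq_gen_renyi_entropy2: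
  "\<forall>\<^sub>F \<mu> in at_top. renyi_entropy \<alpha> \<mu> = gen_renyi_entropy2 \<alpha> 1 \<mu>"
  using eventually_gt_at_top[of 0] by eventually_elim (rule renyi_entropy_eq_gen_renyi_entropy2)

theorem theorem3p4:
  shows
    "(filterlim shannon_entropy at_top at_top \<and>
      (\<forall>\<alpha>::real. \<alpha> > 0 \<and> \<alpha> \<noteq> 1 \<longrightarrow> filterlim (renyi_entropy \<alpha>) at_top at_top) \<and>
      (\<forall>\<alpha>::real. \<alpha> > 0 \<longrightarrow> filterlim (gen_renyi_entropy1 \<alpha>) at_top at_top) \<and>
      (\<forall>(\<alpha>::real) \<beta>::real. \<alpha> > 0 \<and> \<beta> > 0 \<and> \<alpha> \<noteq> \<beta> \<longrightarrow>
         filterlim (gen_renyi_entropy2 \<alpha> \<beta>) at_top at_top) \<and>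
      shannon_entropy \<sim>[at_top] (\<lambda>\<mu>. 1 / 2 * ln (2 * pi * \<mu>) + 1 / 2) \<and>
      (\<forall>\<alpha>::real. \<alpha> > 0 \<and> \<alpha> \<noteq> 1 \<longrightarrow>
         renyi_entropy \<alpha> \<sim>[at_top]
           (\<lambda>\<mu>. 1 / 2 * ln (2 * pi * \<mu>) + ln \<alpha> / (2 * (\<alpha> - 1)))) \<and>
      (\<forall>(\<alpha>::real) \<beta>::real. \<alpha> > 0 \<and> \<beta> > 0 \<and> \<alpha> \<noteq> \<beta> \<longrightarrow>
         gen_renyi_entropy2 \<alpha> \<beta> \<sim>[at_top]
           (\<lambda>\<mu>. 1 / 2 * ln (2 * pi * \<mu>) + (ln \<beta> - ln \<alpha>) / (2 * (\<beta> - \<alpha>))))) \<and>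
     ((\<forall>\<alpha>::real. \<alpha> > 0 \<and> \<alpha> \<noteq> 1 \<longrightarrow>
         (filterlim (tsallis_entropy \<alpha>) at_top at_top \<longleftrightarrow> \<alpha> \<in> {0<..<1})) \<and>
      (\<forall>\<alpha>::real. \<alpha> \<in> {0<..<1} \<longrightarrow>
         tsallis_entropy \<alpha> \<sim>[at_top]
           (\<lambda>\<mu>. 1 / (sqrt \<alpha> * (1 - \<alpha>)) * (2 * pi * \<mu>) powr ((1 - \<alpha>) / 2))) \<and>
      (\<forall>\<alpha>::real. \<alpha> > 1 \<longrightarrow>
         (tsallis_entropy \<alpha> \<longlongrightarrow> 1 / (\<alpha> - 1)) at_top)) \<and>
     ((\<forall>(\<alpha>::real) \<beta>::real. \<alpha> > 0 \<and> \<alpha> \<noteq> 1 \<and> \<beta> > 0 \<and> \<beta> \<noteq> 1 \<longrightarrow>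
         (filterlim (sharma_mittal_entropy \<alpha> \<beta>) at_top at_top \<longleftrightarrow> \<beta> \<in> {0<..<1})) \<and>
      (\<forall>(\<alpha>::real) \<beta>::real. \<alpha> > 0 \<and> \<alpha> \<noteq> 1 \<and> \<beta> \<in> {0<..<1} \<longrightarrow>
         sharma_mittal_entropy \<alpha> \<beta> \<sim>[at_top]
           (\<lambda>\<mu>. 1 / ((1 - \<beta>) * \<alpha> powr ((1 - \<beta>) / (2 * (1 - \<alpha>)))) *
                 (2 * pi * \<mu>) powr ((1 - \<beta>) / 2))) \<and>
      (\<forall>(\<alpha>::real) \<beta>::real. \<alpha> > 0 \<and> \<alpha> \<noteq> 1 \<and> \<beta> > 1 \<longrightarrow>
         (sharma_mittal_entropy \<alpha> \<beta> \<longlongrightarrow> 1 / (\<beta> - 1)) at_top))"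
proof (intro conjI allI impI; (elim conjE)?)
  show "filterlim shannon_entropy at_top at_top"
    using gen_renyi_entropy1_at_top[of 1]
    by (simp add: filterlim_cong[OF refl refl eventually_shannon_entropy_eq_gen_renyi_entropy1])
  \<comment> \<open>The constant \<open>1 / 2\<close> is an instance of the free
    \<open>c\<close>.\<close>
  show "shannon_entropy \<sim>[at_top] (\<lambda>\<mu>. 1 / 2 * ln (2 * pi * \<mu>) + 1 / 2)"
    using gen_renyi_entropy1_asymp_equiv[of 1 "1 / 2"]
    by (subst asymp_equiv_cong[OF eventually_shannon_entropy_eq_gen_renyi_entropy1 always_eventually]) auto
next
  fix \<alpha> :: real
  assume \<alpha>: "\<alpha> > 0"
  then show "filterlim (gen_renyi_entropy1 \<alpha>) at_top at_top"
    by (rule gen_renyi_entropy1_at_top)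
  assume \<alpha>': "\<alpha> \<noteq> 1"
  show "filterlim (renyi_entropy \<alpha>) at_top at_top"
    using gen_renyi_entropy2_at_top[of \<alpha> 1] \<alpha> \<alpha>'
    by (simp add: filterlim_cong[OF refl refl eventually_renyi_entropy_eq_gen_renyi_entropy2])
  \<comment> \<open>Matches the two-parameter constant at \<open>\<beta> = 1\<close> with the form
    stated for the Renyi entropy.\<close>
  have "(ln 1 - ln \<alpha>) / (2 * (1 - \<alpha>)) = ln \<alpha> / (2 * (\<alpha> - 1))"
    using \<alpha>' by (simp add: field_simps)
  then show "renyi_entropy \<alpha> \<sim>[at_top] (\<lambda>\<mu>. 1 / 2 * ln (2 * pi * \<mu>) + ln \<alpha> / (2 * (\<alpha> - 1)))"
    using gen_renyi_entropy2_asymp_equiv[of \<alpha> 1] \<alpha> \<alpha>'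
    by (subst asymp_equiv_cong[OF eventually_renyi_entropy_eq_gen_renyi_entropy2 always_eventually]) auto
  show "filterlim (tsallis_entropy \<alpha>) at_top at_top \<longleftrightarrow> \<alpha> \<in> {0<..<1}"
    using sharma_mittal_entropy_at_top_iff[of \<alpha> \<alpha>] \<alpha> \<alpha>'
    by (simp add: filterlim_cong[OF refl refl eventually_tsallis_entropy_eq_sharma_mittal_entropy])
next
  fix \<alpha> \<beta> :: real
  assume "\<alpha> > 0" "\<beta> > 0" "\<alpha> \<noteq> \<beta>"
  then show "filterlim (gen_renyi_entropy2 \<alpha> \<beta>) at_top at_top"
    and "gen_renyi_entropy2 \<alpha> \<beta> \<sim>[at_top] (\<lambda>\<mu>. 1 / 2 * ln (2 * pi * \<mu>) + (ln \<beta> - ln \<alpha>) / (2 * (\<beta> - \<alpha>)))"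
    by (rule gen_renyi_entropy2_at_top gen_renyi_entropy2_asymp_equiv; assumption)+
next
  fix \<alpha> :: real
  assume "\<alpha> \<in> {0<..<1}"
  then show "tsallis_entropy \<alpha> \<sim>[at_top] (\<lambda>\<mu>. 1 / (sqrt \<alpha> * (1 - \<alpha>)) * (2 * pi * \<mu>) powr ((1 - \<alpha>) / 2))"
    by (intro tsallis_entropy_asymp_equiv) auto
next
  fix \<alpha> :: real
  assume "\<alpha> > 1"
  then show "(tsallis_entropy \<alpha> \<longlongrightarrow> 1 / (\<alpha> - 1)) at_top"
    using sharma_mittal_entropy_tendsto[of \<alpha> \<alpha>]
    by (simp add: filterlim_cong[OF refl refl eventually_tsallis_entropy_eq_sharma_mittal_entropy])
next
  fix \<alpha> \<beta> :: real
  assume \<alpha>: "\<alpha> > 0" "\<alpha> \<noteq> 1"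
  show "filterlim (sharma_mittal_entropy \<alpha> \<beta>) at_top at_top \<longleftrightarrow> \<beta> \<in> {0<..<1}" if "\<beta> > 0" "\<beta> \<noteq> 1"
    using sharma_mittal_entropy_at_top_iff[OF \<alpha>] that by simp
  show "sharma_mittal_entropy \<alpha> \<beta> \<sim>[at_top]
      (\<lambda>\<mu>. 1 / ((1 - \<beta>) * \<alpha> powr ((1 - \<beta>) / (2 * (1 - \<alpha>)))) * (2 * pi * \<mu>) powr ((1 - \<beta>) / 2))"
    if "\<beta> \<in> {0<..<1}"
    using \<alpha> that by (intro sharma_mittal_entropy_asymp_equiv) auto
  show "(sharma_mittal_entropy \<alpha> \<beta> \<longlongrightarrow> 1 / (\<beta> - 1)) at_top" if "\<beta> > 1"
    using \<alpha> that by (rule sharma_mittal_entropy_tendsto)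
qed

end
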